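(* Let $(X_1,d_1)$ and $(X_2,d_2)$ be (nonempty) metric spaces and let $(X_1\times X_2,d)$ be their metric product, i.e. $d\big((x_1,x_2),(x_1',x_2')\big) = \big(d_1^2(x_1,x_1')+d_2^2(x_2,x_2')\big)^{1/2}$. Then $$\mathrm{rank}_E(X_1,d_1)+\mathrm{rank}_E(X_2,d_2)\le \mathrm{rank}_E(X_1\times X_2,d).$$ Moreover, there exist metric spaces $(X_1,d_1)$, $(X_2,d_2)$ for which this inequality is strict.
   Context: A map between metric spaces is called isometric if it preserves distances (it need not be surjective). $\mathbb{E}^n$ denotes $\mathbb{R}^n$ with the Euclidean metric. For a metric space $(X,d)$ the Euclidean rank is $\mathrm{rank}_E(X,d) := \sup\{n \in\mathbb{N} : \text{there exists an isometric map } \mathbb{E}^n\to (X,d)\}$, where $0\in\mathbb{N}$; it takes values in $\mathbb{N}\cup\{\infty\}$. All metric spaces, including those in the final assertion, are nonempty. *)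

theory Defs
  imports "HOL-Analysis.Analysis" "HOL-Library.Extended_Nat"
begin

text \<open>
  A metric space is an element of the library type \<open>'a metric\<close>: a carrier \<open>mspace m\<close> with a
  distance \<open>mdist m\<close>. The carrier may be empty, so nonemptiness has to be assumed where needed.
  The metric product is the library's \<open>prod_metric\<close>.
\<close>

definition isometric_map :: "'a metric \<Rightarrow> 'b metric \<Rightarrow> ('a \<Rightarrow> 'b) \<Rightarrow> bool" where
  "isometric_map m1 m2 f \<longleftrightarrow>
     f \<in> mspace m1 \<rightarrow> mspace m2 \<and>
     (\<forall>x\<in>mspace m1. \<forall>y\<in>mspace m1. mdist m2 (f x) (f y) = mdist m1 x y)"

text \<open>
  As \<open>n\<close> varies inside the supremum below, points of \<open>n\<close>-dimensional space are sequences that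
  vanish from index \<open>n\<close> on, i.e. the points of the library topology \<open>Euclidean_space n\<close>;
  \<open>L2_set f A\<close> is the square root of the sum of \<open>(f i)\<^sup>2\<close> over \<open>i \<in> A\<close>.
\<close>

definition E_metric :: "nat \<Rightarrow> (nat \<Rightarrow> real) metric" where
  "E_metric n =
     metric (topspace (Euclidean_space n), \<lambda>x y. L2_set (\<lambda>i. x i - y i) {..<n})"

definition rank_E :: "'a metric \<Rightarrow> enat" where
  "rank_E m = (SUP n \<in> {n. \<exists>f. isometric_map (E_metric n) m f}. enat n)"

text \<open>The pair in \<open>E_metric_def\<close> is a metric space, so the abstraction \<open>metric\<close> keeps it unchanged.\<close>

lemma Metric_space_E:
  "Metric_space (topspace (Euclidean_space n)) (\<lambda>x y. L2_set (\<lambda>i. x i - y i) {..<n})"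
proof
  fix x y z :: "nat \<Rightarrow> real"
  show "0 \<le> L2_set (\<lambda>i. x i - y i) {..<n}"
    by (rule L2_set_nonneg)
  show "L2_set (\<lambda>i. x i - y i) {..<n} = L2_set (\<lambda>i. y i - x i) {..<n}"
    by (simp add: L2_set_def power2_commute)
  show "L2_set (\<lambda>i. x i - y i) {..<n} = 0 \<longleftrightarrow> x = y"
    if "x \<in> topspace (Euclidean_space n)" "y \<in> topspace (Euclidean_space n)"
    using that by (auto simp: topspace_Euclidean_space L2_set_eq_0_iff fun_eq_iff)
      (metis lessThan_iff not_less)
  show "L2_set (\<lambda>i. x i - z i) {..<n}
      \<le> L2_set (\<lambda>i. x i - y i) {..<n} + L2_set (\<lambda>i. y i - z i) {..<n}"
    using L2_set_triangle_ineq[of "\<lambda>i. x i - y i" "\<lambda>i. y i - z i" "{..<n}"] by simp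
qed

lemma mspace_E [simp]: "mspace (E_metric n) = {x. \<forall>i\<ge>n. x i = 0}"
  unfolding E_metric_def Metric_space.mspace_metric[OF Metric_space_E]
  by (rule topspace_Euclidean_space)

lemma mdist_E: "mdist (E_metric n) = (\<lambda>x y. L2_set (\<lambda>i. x i - y i) {..<n})"
  unfolding E_metric_def by (rule Metric_space.mdist_metric[OF Metric_space_E])

end

theory Submission
  imports Defs "HOL-Computational_Algebra.Polynomial_Factorial" "HOL-Computational_Algebra.Field_as_Ring"
begin

text \<open>
  Superadditivity: concatenate coordinates and apply the two isometric maps separately.

  Strictness: on \<open>\<real>\<^sup>3\<close> put \<open>C v = \<bar>x\<bar>\<^sup>3 + \<bar>y\<bar>\<^sup>3 + \<bar>z\<bar>\<^sup>3\<close> and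
  \<open>N e v = sqrt (8 \<bar>v\<bar>\<^sup>2 + e C v / \<bar>v\<bar>)\<close> for \<open>e = 1, -1\<close>. The weight 8 is large enough to make both
  strictly convex norms. As \<open>(N 1)\<^sup>2 + (N (-1))\<^sup>2\<close> is \<open>16 \<bar>v\<bar>\<^sup>2\<close>, the diagonal embeds Euclidean
  3-space, up to scaling, into the product of the two normed spaces. An isometric image of a Euclidean
  plane in one of them would be flat by strict convexity, so \<open>(N e)\<^sup>2\<close> would be quadratic on a plane.
  Along a line \<open>a + t b\<close> of it, \<open>C\<close> (a polynomial in \<open>t\<close> for large \<open>t\<close>) would be a polynomial
  times \<open>\<bar>a + t b\<bar>\<close>, which is impossible since \<open>\<bar>a + t b\<bar>\<^sup>2\<close> is quadratic without real roots and
  hence not a square. So both factors have rank at most 1 while the product has rank at least 3.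
\<close>

section \<open>Elementary estimates for the absolute cube\<close>

text \<open>As \<open>3 * (x * \<bar>x\<bar>)\<close> is the derivative of the absolute cube, this
  is a first-order Taylor remainder: nonnegative by convexity, and at most quadratic because the
  second derivative is bounded by 6 on the unit interval.\<close>

lemma abs_cube_taylor:
  fixes x y :: real
  assumes "\<bar>x\<bar> \<le> 1" "\<bar>y\<bar> \<le> 1"
  shows "0 \<le> \<bar>y\<bar>^3 - \<bar>x\<bar>^3 - 3 * (x * \<bar>x\<bar>) * (y - x)"
    and "\<bar>y\<bar>^3 - \<bar>x\<bar>^3 - 3 * (x * \<bar>x\<bar>) * (y - x) \<le> 3 * (y - x)^2"
proof -
  have pos: "0 \<le> \<bar>y\<bar>^3 - \<bar>x\<bar>^3 - 3 * (x * \<bar>x\<bar>) * (y - x) \<and>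
      \<bar>y\<bar>^3 - \<bar>x\<bar>^3 - 3 * (x * \<bar>x\<bar>) * (y - x) \<le> 3 * (y - x)^2"
    if "0 \<le> x" "x \<le> 1" "\<bar>y\<bar> \<le> 1" for x y :: real
  proof (cases "0 \<le> y")
    case True
    have "y^3 - x^3 - 3 * (x * x) * (y - x) = (y - x)^2 * (y + 2 * x)"
      by algebra
    moreover have "0 \<le> (y - x)^2 * (y + 2 * x)"
      using that True by simp
    moreover have "(y - x)^2 * (y + 2 * x) \<le> (y - x)^2 * 3"
      using that by (intro mult_left_mono) auto
    ultimately show ?thesis using that True by (simp add: mult.commute)
  next
    case False
    define s where "s = - y"
    have s: "0 \<le> s" "s \<le> 1" "y = - s" using False that by (auto simp: s_def)
    have "s^3 - x^3 - 3 * (x * x) * (- s - x) = s * s^2 + (2 * x) * x^2 + 3 * x * (x * s)"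
      by algebra
    moreover have "0 \<le> s * s^2 + (2 * x) * x^2 + 3 * x * (x * s)"
      using that s by simp
    \<comment> \<open>Between 0 and 1 a cubic monomial is bounded by the quadratic one left after
      dropping a factor.\<close>
    moreover have "s * s^2 \<le> 1 * s^2" "(2 * x) * x^2 \<le> 2 * x^2" "3 * x * (x * s) \<le> 3 * (x * s)"
      using that s mult_right_mono[of s 1 "s^2"] mult_right_mono[of x 1 "x^2"] mult_right_mono[of x 1 "x * s"]
      by simp_all
    moreover have "1 * s^2 + 2 * x^2 + 3 * (x * s) \<le> 3 * (- s - x)^2"
      using that s by (simp add: power2_eq_square algebra_simps)
    ultimately show ?thesis using that s by (simp add: abs_of_nonneg)
  qed
  \<comment> \<open>Negating both \<open>x\<close> and \<open>y\<close> changes neither bound, so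
    \<open>x \<ge> 0\<close> suffices.\<close>
  show "0 \<le> \<bar>y\<bar>^3 - \<bar>x\<bar>^3 - 3 * (x * \<bar>x\<bar>) * (y - x)"
    and "\<bar>y\<bar>^3 - \<bar>x\<bar>^3 - 3 * (x * \<bar>x\<bar>) * (y - x) \<le> 3 * (y - x)^2"
    using pos[of x y] pos[of "-x" "-y"] assms
    by (cases "0 \<le> x"; simp add: power2_commute algebra_simps)+
qed

text \<open>Factor the difference of cubes and absorb the mixed term into the squares; summed over
  coordinates, these squares become squared norms.\<close>

lemma abs_cube_lipschitz:
  fixes x y :: real
  shows "\<bar>\<bar>x\<bar>^3 - \<bar>y\<bar>^3\<bar> \<le> \<bar>x - y\<bar> * (3/2 * (x^2 + y^2))"
proof -
  have "\<bar>x\<bar>^3 - \<bar>y\<bar>^3 = (\<bar>x\<bar> - \<bar>y\<bar>) * (\<bar>x\<bar>^2 + \<bar>x\<bar> * \<bar>y\<bar> + \<bar>y\<bar>^2)"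
    by algebra
  hence "\<bar>\<bar>x\<bar>^3 - \<bar>y\<bar>^3\<bar> = \<bar>\<bar>x\<bar> - \<bar>y\<bar>\<bar> * (\<bar>x\<bar>^2 + \<bar>x\<bar> * \<bar>y\<bar> + \<bar>y\<bar>^2)"
    by (simp add: abs_mult)
  also have "\<dots> \<le> \<bar>x - y\<bar> * (3/2 * (x^2 + y^2))"
  proof (intro mult_mono)
    show "\<bar>x\<bar>^2 + \<bar>x\<bar> * \<bar>y\<bar> + \<bar>y\<bar>^2 \<le> 3/2 * (x^2 + y^2)"
      using sum_squares_bound[of "\<bar>x\<bar>" "\<bar>y\<bar>"] by simp
  qed auto
  finally show ?thesis .
qed

section \<open>The perturbed norms: homogeneity and basic bounds\<close>

definition cubic :: "'a::euclidean_space \<Rightarrow> real" where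
  "cubic v = (\<Sum>b\<in>Basis. \<bar>v \<bullet> b\<bar>^3)"

text \<open>Division by \<open>norm v\<close> makes the perturbation homogeneous of degree 2; at
  \<open>v = 0\<close> the convention \<open>x / 0 = 0\<close> gives the value 0.\<close>

definition bent_sq :: "real \<Rightarrow> 'a::euclidean_space \<Rightarrow> real" where
  "bent_sq e v = 8 * (norm v)^2 + e * cubic v / norm v"

definition bent_norm :: "real \<Rightarrow> 'a::euclidean_space \<Rightarrow> real" where
  "bent_norm e v = sqrt (bent_sq e v)"

text \<open>Half the derivative of \<^const>\<open>bent_sq\<close> at \<open>u\<close> in direction \<open>w\<close>.\<close>

definition bent_form :: "real \<Rightarrow> 'a::euclidean_space \<Rightarrow> 'a \<Rightarrow> real" where
  "bent_form e u w = 8 * (u \<bullet> w) +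
     e * (3 * (\<Sum>b\<in>Basis. (u \<bullet> b) * \<bar>u \<bullet> b\<bar> * (w \<bullet> b)) / norm u - cubic u * (u \<bullet> w) / norm u ^ 3) / 2"

lemma norm_sq_Basis: "(norm v)^2 = (\<Sum>b\<in>Basis. (v \<bullet> b)^2)" for v :: "'a::euclidean_space"
  unfolding power2_norm_eq_inner by (subst euclidean_inner) (simp add: power2_eq_square)

lemma cubic_nonneg [simp]: "0 \<le> cubic v"
  by (simp add: cubic_def sum_nonneg)

lemma cubic_pos: "v \<noteq> 0 \<Longrightarrow> 0 < cubic v"
proof -
  assume "v \<noteq> 0"
  then obtain b where b: "b \<in> Basis" "v \<bullet> b \<noteq> 0" using euclidean_all_zero_iff by blast
  show ?thesis unfolding cubic_def using b by (intro sum_pos2[of _ b]) auto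
qed

lemma cubic_scaleR: "cubic (c *\<^sub>R v) = \<bar>c\<bar>^3 * cubic v"
  by (simp add: cubic_def sum_distrib_left abs_mult power_mult_distrib)

text \<open>In each summand one factor is at most \<open>norm v\<close>; the squares that remain add
  up to \<open>(norm v)^2\<close>.\<close>

lemma cubic_le: "cubic v \<le> norm v ^ 3"
proof -
  have "cubic v \<le> (\<Sum>b\<in>Basis. norm v * (v \<bullet> b)^2)"
    unfolding cubic_def
  proof (rule sum_mono)
    fix b :: 'a assume "b \<in> Basis"
    have "\<bar>v \<bullet> b\<bar>^3 = \<bar>v \<bullet> b\<bar> * (v \<bullet> b)^2" by (simp add: power3_eq_cube power2_eq_square)
    also have "\<dots> \<le> norm v * (v \<bullet> b)^2"
      using \<open>b \<in> Basis\<close> by (intro mult_right_mono) (auto simp: Basis_le_norm)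
    finally show "\<bar>v \<bullet> b\<bar>^3 \<le> norm v * (v \<bullet> b)^2" .
  qed
  also have "\<dots> = norm v * norm v ^ 2"
    by (simp add: sum_distrib_left norm_sq_Basis)
  also have "\<dots> = norm v ^ 3" by (simp add: power3_eq_cube power2_eq_square)
  finally show ?thesis .
qed

lemma bent_sq_scaleR: "bent_sq e (c *\<^sub>R v) = c^2 * bent_sq e v"
proof (cases "c = 0")
  case False
  have "\<bar>c\<bar>^3 = c^2 * \<bar>c\<bar>" by (simp add: power3_eq_cube power2_eq_square)
  then show ?thesis using False
    by (simp add: bent_sq_def cubic_scaleR power_mult_distrib field_simps)
qed (simp add: bent_sq_def)

lemma bent_norm_scaleR: "bent_norm e (c *\<^sub>R v) = \<bar>c\<bar> * bent_norm e v"
  by (simp add: bent_norm_def bent_sq_scaleR real_sqrt_mult)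

lemma bent_form_scaleR_left:
  assumes "0 < c"
  shows "bent_form e (c *\<^sub>R u) w = c * bent_form e u w"
proof -
  have 1: "(\<Sum>b\<in>Basis. (c *\<^sub>R u \<bullet> b) * \<bar>c *\<^sub>R u \<bullet> b\<bar> * (w \<bullet> b)) =
      c^2 * (\<Sum>b\<in>Basis. (u \<bullet> b) * \<bar>u \<bullet> b\<bar> * (w \<bullet> b))"
    using assms by (simp add: sum_distrib_left abs_mult power2_eq_square mult_ac)
  show ?thesis using assms
    unfolding bent_form_def 1
    by (simp add: cubic_scaleR power_mult_distrib power2_eq_square power3_eq_cube algebra_simps)
qed

lemma bent_form_add: "bent_form e u (v + w) = bent_form e u v + bent_form e u w"
  by (simp add: bent_form_def inner_add_left inner_add_right ring_distribs sum.distrib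
      add_divide_distrib diff_divide_distrib)

lemma bent_form_scaleR_right: "bent_form e u (c *\<^sub>R w) = c * bent_form e u w"
proof -
  have "(\<Sum>b\<in>Basis. (u \<bullet> b) * \<bar>u \<bullet> b\<bar> * (c *\<^sub>R w \<bullet> b)) =
      c * (\<Sum>b\<in>Basis. (u \<bullet> b) * \<bar>u \<bullet> b\<bar> * (w \<bullet> b))"
    by (simp add: sum_distrib_left mult_ac)
  then show ?thesis unfolding bent_form_def by (simp add: algebra_simps)
qed

text \<open>Euler's identity for a function homogeneous of degree 2.\<close>

lemma bent_form_self: "bent_form e u u = bent_sq e u"
proof (cases "u = 0")
  case False
  have "(u \<bullet> b) * \<bar>u \<bullet> b\<bar> * (u \<bullet> b) = \<bar>u \<bullet> b\<bar>^3" for b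
    by (cases "0 \<le> u \<bullet> b") (auto simp: power3_eq_cube)
  then have "(\<Sum>b\<in>Basis. (u \<bullet> b) * \<bar>u \<bullet> b\<bar> * (u \<bullet> b)) = cubic u"
    by (simp add: cubic_def)
  then show ?thesis using False
    by (simp add: bent_form_def bent_sq_def flip: power2_norm_eq_inner)
      (simp add: field_simps power2_eq_square power3_eq_cube)
qed (simp add: bent_form_def bent_sq_def)

text \<open>By \<open>cubic_le\<close> the perturbation takes away at most one of the eight copies
  of \<open>(norm v)^2\<close>.\<close>

lemma bent_sq_ge:
  assumes "\<bar>e\<bar> \<le> 1"
  shows "7 * (norm v)^2 \<le> bent_sq e v"
proof (cases "v = 0")
  case False
  have 1: "cubic v / norm v \<le> norm v ^ 2"
    using cubic_le[of v] False by (simp add: field_simps power2_eq_square power3_eq_cube)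
  have "\<bar>e * (cubic v / norm v)\<bar> \<le> 1 * (cubic v / norm v)"
    unfolding abs_mult using assms by (intro mult_mono) auto
  with 1 have "- (e * (cubic v / norm v)) \<le> norm v ^ 2" by linarith
  then show ?thesis unfolding bent_sq_def by simp
qed (simp add: bent_sq_def)

lemma bent_norm_nonneg:
  assumes "\<bar>e\<bar> \<le> 1"
  shows "0 \<le> bent_norm e v"
proof -
  have "0 \<le> bent_sq e v" using bent_sq_ge[OF assms, of v] zero_le_power2[of "norm v"] by linarith
  then show ?thesis by (simp add: bent_norm_def)
qed

lemma bent_norm_sq:
  assumes "\<bar>e\<bar> \<le> 1"
  shows "bent_norm e v ^ 2 = bent_sq e v"
proof -
  have "0 \<le> bent_sq e v" using bent_sq_ge[OF assms, of v] zero_le_power2[of "norm v"] by linarith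
  then show ?thesis by (simp add: bent_norm_def)
qed

lemma bent_norm_eq_0_iff:
  assumes "\<bar>e\<bar> \<le> 1"
  shows "bent_norm e v = 0 \<longleftrightarrow> v = 0"
proof
  assume "bent_norm e v = 0"
  then have "7 * (norm v)^2 \<le> 0" using bent_sq_ge[OF assms, of v] by (simp add: bent_norm_def)
  then show "v = 0" by simp
qed (simp add: bent_norm_def bent_sq_def)

section \<open>A quantitative Cauchy-Schwarz inequality and strict convexity\<close>

text \<open>Let d be the squared distance of \<open>u\<close> and \<open>w\<close>. Compared with
  the mean of \<open>bent_sq e u\<close> and \<open>bent_sq e w\<close>, the Euclidean part loses 4d
  and the cubic part regains at most 3d/2. Passing from that mean to the product of the norms costs
  at most d/2, which leaves 2d.\<close>

lemma bent_form_le_unit: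
  assumes e: "\<bar>e\<bar> \<le> 1" and u: "norm u = 1" and w: "norm w = 1"
  shows "bent_form e u w \<le> bent_norm e u * bent_norm e w - 2 * (norm (u - w))^2"
proof -
  define d where "d = (norm (u - w))^2"
  define S where "S = (\<Sum>b\<in>Basis. (u \<bullet> b) * \<bar>u \<bullet> b\<bar> * (w \<bullet> b))"
  \<comment> \<open>The coordinatewise Taylor remainders of the absolute cube, so \<open>T\<close>
    lies between 0 and \<open>3 * d\<close>.\<close>
  define T where "T = (\<Sum>b\<in>Basis. \<bar>w \<bullet> b\<bar>^3 - \<bar>u \<bullet> b\<bar>^3 - 3 * ((u \<bullet> b) * \<bar>u \<bullet> b\<bar>) * (w \<bullet> b - u \<bullet> b))"
  have uu: "u \<bullet> u = 1" "w \<bullet> w = 1"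
    using u w by (simp_all flip: power2_norm_eq_inner)
  have uw: "u \<bullet> w = 1 - d / 2"
    unfolding d_def power2_norm_eq_inner using uu
    by (simp add: inner_diff_left inner_diff_right inner_commute field_simps)
  have d0: "0 \<le> d" by (simp add: d_def)
  have le1: "\<bar>u \<bullet> b\<bar> \<le> 1" "\<bar>w \<bullet> b\<bar> \<le> 1" if "b \<in> Basis" for b
    using Basis_le_norm[OF that] u w by metis+
  have T0: "0 \<le> T"
    unfolding T_def by (intro sum_nonneg abs_cube_taylor(1) le1)
  have "T \<le> (\<Sum>b\<in>Basis. 3 * (w \<bullet> b - u \<bullet> b)^2)"
    unfolding T_def by (intro sum_mono abs_cube_taylor(2) le1)
  also have "\<dots> = 3 * d"
    by (simp add: d_def norm_sq_Basis inner_diff_left sum_distrib_left power2_commute)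
  finally have T3: "T \<le> 3 * d" .
  have cube: "(u \<bullet> b) * \<bar>u \<bullet> b\<bar> * (u \<bullet> b) = \<bar>u \<bullet> b\<bar>^3" for b
    by (cases "0 \<le> u \<bullet> b") (auto simp: power3_eq_cube)
  have "T = (\<Sum>b\<in>Basis. \<bar>w \<bullet> b\<bar>^3 + 2 * \<bar>u \<bullet> b\<bar>^3 - 3 * ((u \<bullet> b) * \<bar>u \<bullet> b\<bar> * (w \<bullet> b)))"
    unfolding T_def by (intro sum.cong refl) (simp add: algebra_simps flip: cube)
  then have T: "T = cubic w + 2 * cubic u - 3 * S"
    by (simp add: cubic_def S_def sum.distrib sum_subtractf sum_distrib_left)
  have cu: "cubic u \<le> 1" "0 \<le> cubic u" using cubic_le[of u] u by simp_all
  \<comment> \<open>\<open>B\<close> joins the Taylor remainder with the correction due to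
    \<open>u \<bullet> w = 1 - d / 2\<close> in the last term of \<open>bent_form\<close>.\<close>
  define B where "B = T - cubic u * (d / 2)"
  have "cubic u * (d / 2) \<le> 1 * (d / 2)" using cu d0 by (intro mult_right_mono) auto
  moreover have "0 \<le> cubic u * (d / 2)" using cu d0 by simp
  ultimately have "\<bar>B\<bar> \<le> 3 * d" unfolding B_def using T0 T3 d0 by linarith
  then have "\<bar>e * B\<bar> \<le> 1 * (3 * d)" unfolding abs_mult using e by (intro mult_mono) auto
  then have eB: "- (e * B) \<le> 3 * d" by linarith
  have "bent_form e u w = (bent_sq e u + bent_sq e w) / 2 - 4 * d - e * B / 2"
    unfolding bent_form_def bent_sq_def B_def T u w S_def[symmetric] uw by (simp add: field_simps)
  also have "\<dots> \<le> (bent_sq e u + bent_sq e w) / 2 - 5/2 * d"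
    using eB by simp
  finally have form: "bent_form e u w \<le> (bent_sq e u + bent_sq e w) / 2 - 5/2 * d" .
  \<comment> \<open>The mean of \<open>m^2\<close> and \<open>n^2\<close> exceeds
    \<open>m * n\<close> by half of \<open>(m - n)^2\<close>. That square is bounded by
    \<open>d\<close> through a Lipschitz bound on \<open>m^2 - n^2\<close> and a lower bound on
    \<open>m + n\<close>.\<close>
  define m n where "m = bent_norm e u" and "n = bent_norm e w"
  have mn: "m^2 = bent_sq e u" "n^2 = bent_sq e w" "0 \<le> m" "0 \<le> n"
    using e by (simp_all add: m_def n_def bent_norm_sq bent_norm_nonneg)
  have "cubic u - cubic w = (\<Sum>b\<in>Basis. \<bar>u \<bullet> b\<bar>^3 - \<bar>w \<bullet> b\<bar>^3)"
    by (simp add: cubic_def sum_subtractf)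
  also have "\<bar>\<dots>\<bar> \<le> (\<Sum>b\<in>Basis. norm (u - w) * (3/2 * ((u \<bullet> b)^2 + (w \<bullet> b)^2)))"
  proof (rule order_trans[OF sum_abs sum_mono])
    fix b :: 'a assume "b \<in> Basis"
    then have "\<bar>u \<bullet> b - w \<bullet> b\<bar> \<le> norm (u - w)"
      using Basis_le_norm[of b "u - w"] by (simp add: inner_diff_left)
    then show "\<bar>\<bar>u \<bullet> b\<bar>^3 - \<bar>w \<bullet> b\<bar>^3\<bar> \<le> norm (u - w) * (3/2 * ((u \<bullet> b)^2 + (w \<bullet> b)^2))"
      by (intro order_trans[OF abs_cube_lipschitz mult_right_mono]) auto
  qed
  also have "\<dots> = norm (u - w) * (3/2 * ((norm u)^2 + (norm w)^2))"
    by (simp only: norm_sq_Basis sum.distrib sum_distrib_left[symmetric])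
  finally have "\<bar>cubic u - cubic w\<bar> \<le> 3 * norm (u - w)" using u w by simp
  then have "\<bar>e\<bar> * \<bar>cubic u - cubic w\<bar> \<le> 1 * (3 * norm (u - w))"
    using e by (intro mult_mono) auto
  moreover have "m^2 - n^2 = e * (cubic u - cubic w)"
    unfolding mn bent_sq_def u w by (simp add: algebra_simps)
  ultimately have "\<bar>m^2 - n^2\<bar> \<le> 3 * norm (u - w)" by (simp add: abs_mult)
  then have "(m^2 - n^2)^2 \<le> (3 * norm (u - w))^2"
    using power_mono[of "\<bar>m^2 - n^2\<bar>" "3 * norm (u - w)" 2] by simp
  moreover have "m^2 - n^2 = (m - n) * (m + n)" by algebra
  ultimately have "(m - n)^2 * (m + n)^2 \<le> 9 * d"
    by (simp add: d_def power_mult_distrib)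
  moreover have "7 \<le> m^2" "7 \<le> n^2" "0 \<le> m * n"
    using mn bent_sq_ge[OF e, of u] bent_sq_ge[OF e, of w] u w by auto
  \<comment> \<open>Chosen to cancel the square of the Lipschitz constant 3.\<close>
  then have "9 \<le> (m + n)^2" unfolding power2_sum by linarith
  then have "(m - n)^2 * 9 \<le> (m - n)^2 * (m + n)^2" by (intro mult_left_mono) auto
  ultimately have "(m - n)^2 \<le> d" by simp
  then have "(bent_sq e u + bent_sq e w) / 2 \<le> m * n + d / 2"
    unfolding power2_diff mn by simp
  then have "bent_form e u w \<le> m * n - 2 * d" using form by argo
  then show ?thesis by (simp add: m_def n_def d_def)
qed

text \<open>Both sides scale linearly in \<open>u\<close> and in \<open>w\<close> under positive
  factors, which reduces the claim to unit vectors.\<close>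

lemma bent_form_le:
  assumes e: "\<bar>e\<bar> \<le> 1" and "u \<noteq> 0" "w \<noteq> 0"
  shows "bent_form e u w \<le> bent_norm e u * bent_norm e w - 2 * norm u * norm w * (norm (sgn u - sgn w))^2"
proof -
  have u: "norm u *\<^sub>R sgn u = u" and w: "norm w *\<^sub>R sgn w = w"
    using assms by (simp_all add: sgn_div_norm)
  have "bent_form e (norm u *\<^sub>R sgn u) (norm w *\<^sub>R sgn w) =
      norm u * norm w * bent_form e (sgn u) (sgn w)"
    using assms by (simp add: bent_form_scaleR_left bent_form_scaleR_right)
  also have "\<dots> \<le> norm u * norm w *
      (bent_norm e (sgn u) * bent_norm e (sgn w) - 2 * (norm (sgn u - sgn w))^2)"
    using assms by (intro mult_left_mono bent_form_le_unit) (auto simp: norm_sgn)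
  also have "\<dots> = bent_norm e (norm u *\<^sub>R sgn u) * bent_norm e (norm w *\<^sub>R sgn w)
      - 2 * norm u * norm w * (norm (sgn u - sgn w))^2"
    by (simp add: bent_norm_scaleR algebra_simps)
  finally show ?thesis unfolding u w .
qed

lemma bent_form_le_norms:
  assumes "\<bar>e\<bar> \<le> 1"
  shows "bent_form e u w \<le> bent_norm e u * bent_norm e w"
proof (cases "u = 0 \<or> w = 0")
  case True
  then show ?thesis by (auto simp: bent_form_def bent_norm_def bent_sq_def)
next
  case False
  have "0 \<le> 2 * norm u * norm w * (norm (sgn u - sgn w))^2" by simp
  then show ?thesis using bent_form_le[OF assms, of u w] False by linarith
qed

text \<open>The linear functional \<open>bent_form e (x + y)\<close> supports the unit ball in the
  direction \<open>x + y\<close>: split its value at \<open>x + y\<close> over the summands, bound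
  each, and cancel one factor.\<close>

lemma bent_norm_triangle:
  assumes e: "\<bar>e\<bar> \<le> 1"
  shows "bent_norm e (x + y) \<le> bent_norm e x + bent_norm e y"
proof (cases "x + y = 0")
  case True
  then show ?thesis using bent_norm_nonneg[OF e, of x] bent_norm_nonneg[OF e, of y]
    by (simp add: bent_norm_eq_0_iff[OF e, THEN iffD2])
next
  case False
  have "bent_norm e (x + y) * bent_norm e (x + y) = bent_form e (x + y) x + bent_form e (x + y) y"
    using bent_norm_sq[OF e, of "x + y"]
    by (simp add: power2_eq_square bent_form_self flip: bent_form_add)
  also have "\<dots> \<le> bent_norm e (x + y) * (bent_norm e x + bent_norm e y)"
    unfolding distrib_left by (intro add_mono bent_form_le_norms[OF e])
  finally show ?thesis
    using False bent_norm_nonneg[OF e, of "x + y"] bent_norm_eq_0_iff[OF e, of "x + y"]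
    by (simp add: mult_le_cancel_left)
qed

text \<open>Equality makes the support estimate for \<open>x\<close> sharp, so its defect term
  vanishes and \<open>x\<close> points along \<open>x + y\<close>; comparing norms identifies the
  factor as \<open>l\<close>.\<close>

lemma bent_norm_strict:
  assumes e: "\<bar>e\<bar> \<le> 1"
    and eq: "bent_norm e (x + y) = bent_norm e x + bent_norm e y"
    and x: "bent_norm e x = l * bent_norm e (x + y)" and s: "x + y \<noteq> 0"
  shows "x = l *\<^sub>R (x + y)"
proof (cases "x = 0")
  case True
  then show ?thesis using x s bent_norm_eq_0_iff[OF e, of y] bent_norm_eq_0_iff[OF e, of "0::'a"] by auto
next
  case False
  have "bent_norm e (x + y) * (bent_norm e x + bent_norm e y) =
      bent_form e (x + y) x + bent_form e (x + y) y"
    using bent_norm_sq[OF e, of "x + y"]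
    by (simp add: power2_eq_square bent_form_self eq flip: bent_form_add)
  \<comment> \<open>The sum is attained and the part of \<open>y\<close> is bounded above, so the
    part of \<open>x\<close> is bounded below.\<close>
  then have "bent_norm e (x + y) * bent_norm e x \<le> bent_form e (x + y) x"
    using bent_form_le_norms[OF e, of "x + y" y] by (simp add: ring_distribs)
  then have "2 * norm (x + y) * norm x * (norm (sgn (x + y) - sgn x))^2 \<le> 0"
    using bent_form_le[OF e s False] by linarith
  then have "(norm (sgn (x + y) - sgn x))^2 \<le> 0"
    using s False by (simp add: mult_le_0_iff)
  then have sg: "sgn x = sgn (x + y)" by simp
  define k where "k = norm x / norm (x + y)"
  have "x = norm x *\<^sub>R sgn x" using False by (simp add: sgn_div_norm)
  also have "\<dots> = k *\<^sub>R (x + y)"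
    unfolding sg by (simp add: sgn_div_norm k_def divide_inverse)
  finally have k: "x = k *\<^sub>R (x + y)" .
  have "0 \<le> k" by (simp add: k_def)
  then have "bent_norm e x = k * bent_norm e (x + y)"
    by (subst k) (simp add: bent_norm_scaleR)
  then have "k = l" using x s bent_norm_eq_0_iff[OF e, of "x + y"] by simp
  with k show ?thesis by simp
qed

section \<open>Polynomials along rays exclude Euclidean planes\<close>

text \<open>An affine function has constant sign for large \<open>t\<close>.\<close>

lemma eventually_abs_cube_poly:
  fixes a b :: real
  shows "\<exists>p. eventually (\<lambda>t. \<bar>a + t * b\<bar>^3 = poly p t) at_top"
proof -
  consider "b = 0" | "0 < b" | "b < 0" by linarith
  then show ?thesis
  proof cases
    case 1
    then show ?thesis by (intro exI[of _ "[:\<bar>a\<bar>^3:]"]) simp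
  next
    case 2
    show ?thesis
    proof (intro exI[of _ "[:a, b:]^3"] eventually_mono[OF eventually_ge_at_top[of "- a / b"]])
      fix t assume "- a / b \<le> t"
      then have "0 \<le> a + t * b" using 2 by (simp add: field_simps)
      then show "\<bar>a + t * b\<bar>^3 = poly ([:a, b:]^3) t" by simp
    qed
  next
    case 3
    show ?thesis
    proof (intro exI[of _ "[:-a, -b:]^3"] eventually_mono[OF eventually_ge_at_top[of "- a / b"]])
      fix t assume "- a / b \<le> t"
      then have "a + t * b \<le> 0" using 3 by (simp add: field_simps)
      then show "\<bar>a + t * b\<bar>^3 = poly ([:-a, -b:]^3) t" by (simp add: abs_of_nonpos)
    qed
  qed
qed

lemma eventually_cubic_poly:
  fixes a b :: "'a::euclidean_space"
  shows "\<exists>p. eventually (\<lambda>t. cubic (a + t *\<^sub>R b) = poly p t) at_top"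
proof -
  have "\<exists>p. eventually (\<lambda>t. \<bar>a \<bullet> i + t * (b \<bullet> i)\<bar>^3 = poly p t) at_top" for i
    by (rule eventually_abs_cube_poly)
  then obtain p where p: "eventually (\<lambda>t. \<bar>a \<bullet> i + t * (b \<bullet> i)\<bar>^3 = poly (p i) t) at_top" for i
    by metis
  have "eventually (\<lambda>t. \<forall>i\<in>Basis. \<bar>a \<bullet> i + t * (b \<bullet> i)\<bar>^3 = poly (p i) t) at_top"
    using p by (simp add: eventually_ball_finite)
  then have "eventually (\<lambda>t. cubic (a + t *\<^sub>R b) = poly (\<Sum>i\<in>Basis. p i) t) at_top"
    by eventually_elim (simp add: cubic_def inner_add_left poly_sum)
  then show ?thesis by blast
qed

lemma poly_eqI_at_top:
  fixes p q :: "real poly"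
  assumes "eventually (\<lambda>t. poly p t = poly q t) at_top"
  shows "p = q"
proof (rule ccontr)
  assume "p \<noteq> q"
  then have "finite {t. poly (p - q) t = 0}" by (intro poly_roots_finite) simp
  moreover obtain T where "\<And>t. T \<le> t \<Longrightarrow> poly p t = poly q t"
    using assms by (auto simp: eventually_at_top_linorder)
  then have "{T..} \<subseteq> {t. poly (p - q) t = 0}" by auto
  ultimately have "finite {T..}" by (rule rev_finite_subset)
  then show False using infinite_Ici by blast
qed

text \<open>Unique factorization turns \<open>Q^2 dvd C^2\<close> into \<open>Q dvd C\<close>;
  cancelling \<open>Q^2\<close> exhibits \<open>R\<close> as the square of a linear polynomial,
  which has a real root.\<close>

lemma no_square_multiple:
  fixes C Q R :: "real poly"
  assumes eq: "C^2 = Q^2 * R" and "Q \<noteq> 0" and deg: "degree R = 2" and nz: "\<And>t. poly R t \<noteq> 0"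
  shows False
proof -
  have "Q^2 dvd C^2" using eq by simp
  then have "Q dvd C" by (simp add: pow_divides_pow_iff)
  then obtain L where L: "C = Q * L" by blast
  then have R: "L^2 = R" using eq \<open>Q \<noteq> 0\<close> by (simp add: power_mult_distrib)
  then have "2 * degree L = 2" using deg degree_power_eq[of L 2] by (cases "L = 0") auto
  then have "degree L = 1" by simp
  then obtain a b where ab: "L = [:a, b:]" "b \<noteq> 0" by (metis degree1_coeffs)
  then have "poly L (- a / b) = 0" by simp
  then have "poly R (- a / b) = 0" by (simp flip: R)
  with nz show False by blast
qed

text \<open>Here \<open>a\<close> and \<open>b\<close> play the role of the images of two
  orthonormal vectors under a linear map that multiplies lengths by 4.\<close>

lemma bent_norm_no_plane:
  fixes a b :: "'a::euclidean_space"
  assumes e: "\<bar>e\<bar> \<le> 1" "e \<noteq> 0"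
    and pl: "\<And>t. 0 \<le> t \<Longrightarrow> bent_sq e (a + t *\<^sub>R b) = 16 * (1 + t^2)"
  shows False
proof -
  have b0: "b \<noteq> 0" using pl[of 0] pl[of 1] by auto
  \<comment> \<open>The hypothesis covers only nonnegative parameters. If the line met the origin at
    \<open>t\<close>, then \<open>bent_sq\<close> would be a multiple of \<open>(s - t)^2\<close>
    along it, which contradicts the values at \<open>s = 0, 1, 2\<close>.\<close>
  have nz: "a + t *\<^sub>R b \<noteq> 0" for t
  proof
    assume "a + t *\<^sub>R b = 0"
    then have a: "a = (- t) *\<^sub>R b" by (simp add: add_eq_0_iff2)
    have "bent_sq e (a + s *\<^sub>R b) = (s - t)^2 * bent_sq e b" for s
    proof -
      have "a + s *\<^sub>R b = (s - t) *\<^sub>R b" unfolding a by (simp add: algebra_simps)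
      then show ?thesis by (simp only: bent_sq_scaleR)
    qed
    then have "(s - t)^2 * bent_sq e b = 16 * (1 + s^2)" if "0 \<le> s" for s
      using pl[OF that] by simp
    from this[of 0] this[of 1] this[of 2]
    have "t * (t * bent_sq e b) = 16" "bent_sq e b = 16 + 2 * (t * bent_sq e b)"
      "4 * bent_sq e b = 64 + 4 * (t * bent_sq e b)"
      by (simp_all add: power2_eq_square algebra_simps)
    moreover from this have "t * bent_sq e b = 0" by linarith
    ultimately show False by simp
  qed
  define R where "R = [:a \<bullet> a, 2 * (a \<bullet> b), b \<bullet> b:]"
  \<comment> \<open>What the perturbation \<open>e * cubic / norm\<close> must equal on the
    ray.\<close>
  define Q where "Q = [:16, 0, 16:] - smult 8 R"
  have R: "poly R t = (norm (a + t *\<^sub>R b))^2" for t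
    unfolding R_def power2_norm_eq_inner
    by (simp add: inner_add_left inner_add_right inner_commute algebra_simps)
  obtain p where p: "eventually (\<lambda>t. cubic (a + t *\<^sub>R b) = poly p t) at_top"
    using eventually_cubic_poly by blast
  have ev: "eventually (\<lambda>t. e * poly p t = poly Q t * norm (a + t *\<^sub>R b)) at_top"
    using p eventually_ge_at_top[of 0]
  proof eventually_elim
    case (elim t)
    have "poly Q t = e * poly p t / norm (a + t *\<^sub>R b)"
      using pl[of t] elim by (simp add: Q_def R bent_sq_def power2_eq_square algebra_simps)
    then show ?case using nz[of t] by simp
  qed
  \<comment> \<open>Squaring replaces the norm by the polynomial \<open>R\<close>.\<close>
  have "smult e p ^ 2 = Q^2 * R"
  proof (rule poly_eqI_at_top)
    show "eventually (\<lambda>t. poly (smult e p ^ 2) t = poly (Q^2 * R) t) at_top"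
      using ev by eventually_elim (simp add: R flip: power_mult_distrib)
  qed
  \<comment> \<open>Otherwise \<open>cubic\<close> would vanish at nonzero points of the
    ray.\<close>
  moreover have "Q \<noteq> 0"
  proof
    assume "Q = 0"
    have "eventually (\<lambda>t::real. False) at_top"
      using p ev
    proof eventually_elim
      case (elim t)
      then show ?case using cubic_pos[OF nz[of t]] e \<open>Q = 0\<close> by simp
    qed
    then show False by simp
  qed
  moreover have "degree R = 2" using b0 by (simp add: R_def)
  moreover have "poly R t \<noteq> 0" for t using nz by (simp add: R)
  ultimately show False using no_square_multiple by blast
qed

text \<open>Strict convexity makes \<open>h\<close> affine on the segment from (1, 0) to (0, 1);
  homogeneity carries the known distances from \<open>h 0 0\<close> to this segment over to a whole
  ray, as \<open>bent_norm_no_plane\<close> requires.\<close>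

lemma bent_norm_no_isometry:
  fixes h :: "real \<Rightarrow> real \<Rightarrow> 'a::euclidean_space"
  assumes e: "\<bar>e\<bar> \<le> 1" "e \<noteq> 0"
    and h: "\<And>s t s' t'. bent_norm e (h s t - h s' t') = 4 * sqrt ((s - s')^2 + (t - t')^2)"
  shows False
proof (rule bent_norm_no_plane[OF e])
  fix t :: real assume t: "0 \<le> t"
  \<comment> \<open>the point where the segment from \<open>(1, 0)\<close> to \<open>(0, 1)\<close> meets the ray through \<open>(1, t)\<close>\<close>
  define l where "l = t / (1 + t)"
  have l: "0 \<le> l" "l \<le> 1" "1 - l = 1 / (1 + t)" using t by (auto simp: l_def field_simps)
  define x where "x = h (1 - l) l - h 1 0"
  define y where "y = h 0 1 - h (1 - l) l"
  have xy: "x + y = h 0 1 - h 1 0" by (simp add: x_def y_def)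
  have sq: "sqrt (c^2 + c^2) = c * sqrt 2" if "0 \<le> c" for c :: real
    using that by (simp add: real_sqrt_mult flip: mult_2)
  have nx: "bent_norm e x = l * bent_norm e (x + y)"
    unfolding xy unfolding x_def h using sq[of l] l(1) by simp
  have ny: "bent_norm e y = (1 - l) * bent_norm e (x + y)"
    unfolding xy unfolding y_def h using sq[of "1 - l"] l(2) by (simp add: power2_commute)
  have "bent_norm e (x + y) \<noteq> 0" unfolding xy h by simp
  then have "x + y \<noteq> 0" using bent_norm_eq_0_iff[OF e(1), of "x + y"] by blast
  \<comment> \<open>The three plane points are collinear, so the triangle inequality is an
    equality.\<close>
  moreover have "bent_norm e (x + y) = bent_norm e x + bent_norm e y"
    unfolding nx ny by (simp add: algebra_simps)
  ultimately have "x = l *\<^sub>R (x + y)" using bent_norm_strict[OF e(1) _ nx] by blast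
  then have "h (1 - l) l = h 1 0 + l *\<^sub>R (h 0 1 - h 1 0)"
    unfolding xy by (simp add: x_def algebra_simps)
  then have "h (1 - l) l - h 0 0 = (1 - l) *\<^sub>R (h 1 0 - h 0 0) + l *\<^sub>R (h 0 1 - h 0 0)"
    by (simp add: algebra_simps)
  then have "(1 + t) *\<^sub>R (h (1 - l) l - h 0 0) =
      ((1 + t) * (1 - l)) *\<^sub>R (h 1 0 - h 0 0) + ((1 + t) * l) *\<^sub>R (h 0 1 - h 0 0)"
    by (simp add: scaleR_add_right)
  moreover have "(1 + t) * (1 - l) = 1" "(1 + t) * l = t"
    using t by (simp_all add: l(3)) (simp add: l_def)
  ultimately have "(h 1 0 - h 0 0) + t *\<^sub>R (h 0 1 - h 0 0) = (1 + t) *\<^sub>R (h (1 - l) l - h 0 0)"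
    by simp
  then have "bent_sq e ((h 1 0 - h 0 0) + t *\<^sub>R (h 0 1 - h 0 0)) =
      (1 + t)^2 * bent_norm e (h (1 - l) l - h 0 0) ^ 2"
    by (simp add: bent_sq_scaleR bent_norm_sq[OF e(1)])
  also have "\<dots> = 16 * (((1 + t) * (1 - l))^2 + ((1 + t) * l)^2)"
    unfolding h power_mult_distrib by (simp add: algebra_simps)
  also have "\<dots> = 16 * (1 + t^2)"
    using \<open>(1 + t) * (1 - l) = 1\<close> \<open>(1 + t) * l = t\<close> by simp
  finally show "bent_sq e ((h 1 0 - h 0 0) + t *\<^sub>R (h 0 1 - h 0 0)) = 16 * (1 + t^2)" .
qed

section \<open>The two factor spaces and their ranks\<close>

text \<open>Links the sequences that serve as points to a type of class
  \<open>euclidean_space\<close>, where \<open>bent_norm\<close> is defined.\<close>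

definition to_R3 :: "(nat \<Rightarrow> real) \<Rightarrow> real \<times> real \<times> real" where
  "to_R3 x = (x 0, x 1, x 2)"

text \<open>The squares of the two norms add up to 16 times the Euclidean square; dividing by 4
  makes the diagonal exactly isometric.\<close>

definition bent_metric :: "real \<Rightarrow> (nat \<Rightarrow> real) metric" where
  "bent_metric e = metric (mspace (E_metric 3), \<lambda>x y. bent_norm e (to_R3 x - to_R3 y) / 4)"

lemma to_R3_inj:
  assumes "x \<in> mspace (E_metric 3)" "y \<in> mspace (E_metric 3)" "to_R3 x = to_R3 y"
  shows "x = y"
proof
  fix i :: nat
  consider "i = 0" | "i = 1" | "i = 2" | "3 \<le> i" by linarith
  then show "x i = y i" using assms by cases (auto simp: to_R3_def)
qed

lemma Metric_space_bent:
  assumes e: "\<bar>e\<bar> \<le> 1"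
  shows "Metric_space (mspace (E_metric 3)) (\<lambda>x y. bent_norm e (to_R3 x - to_R3 y) / 4)"
proof
  fix x y z :: "nat \<Rightarrow> real"
  show "0 \<le> bent_norm e (to_R3 x - to_R3 y) / 4"
    using bent_norm_nonneg[OF e] by simp
  show "bent_norm e (to_R3 x - to_R3 y) / 4 = bent_norm e (to_R3 y - to_R3 x) / 4"
    using bent_norm_scaleR[of e "-1" "to_R3 x - to_R3 y"] by simp
  show "bent_norm e (to_R3 x - to_R3 y) / 4 = 0 \<longleftrightarrow> x = y"
    if "x \<in> mspace (E_metric 3)" "y \<in> mspace (E_metric 3)"
  proof
    assume "bent_norm e (to_R3 x - to_R3 y) / 4 = 0"
    then have "to_R3 x - to_R3 y = 0" by (simp add: bent_norm_eq_0_iff[OF e])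
    then show "x = y" using to_R3_inj[OF that] by simp
  qed (simp add: bent_norm_eq_0_iff[OF e])
  show "bent_norm e (to_R3 x - to_R3 z) / 4
      \<le> bent_norm e (to_R3 x - to_R3 y) / 4 + bent_norm e (to_R3 y - to_R3 z) / 4"
    using bent_norm_triangle[OF e, of "to_R3 x - to_R3 y" "to_R3 y - to_R3 z"] by simp
qed

lemma mspace_bent: "\<bar>e\<bar> \<le> 1 \<Longrightarrow> mspace (bent_metric e) = mspace (E_metric 3)"
  unfolding bent_metric_def by (rule Metric_space.mspace_metric[OF Metric_space_bent])

lemma mdist_bent:
  "\<bar>e\<bar> \<le> 1 \<Longrightarrow> mdist (bent_metric e) = (\<lambda>x y. bent_norm e (to_R3 x - to_R3 y) / 4)"
  unfolding bent_metric_def by (rule Metric_space.mdist_metric[OF Metric_space_bent])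

lemma isometric_map_dist:
  "isometric_map X Y f \<Longrightarrow> x \<in> mspace X \<Longrightarrow> y \<in> mspace X \<Longrightarrow> mdist Y (f x) (f y) = mdist X x y"
  by (simp add: isometric_map_def)

text \<open>An isometric map from dimension at least 2 restricts to the plane of the first two
  coordinates.\<close>

lemma rank_bent_le:
  assumes e: "\<bar>e\<bar> \<le> 1" "e \<noteq> 0"
  shows "rank_E (bent_metric e) \<le> 1"
  unfolding rank_E_def
proof (rule SUP_least)
  fix n assume "n \<in> {n. \<exists>f. isometric_map (E_metric n) (bent_metric e) f}"
  then obtain f where f: "isometric_map (E_metric n) (bent_metric e) f" by blast
  have "n \<le> 1"
  proof (rule ccontr)
    assume "\<not> n \<le> 1"
    then have n: "2 \<le> n" by simp
    define p :: "real \<Rightarrow> real \<Rightarrow> nat \<Rightarrow> real" where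
      "p s t = (\<lambda>i. if i = 0 then s else if i = 1 then t else 0)" for s t
    have p: "p s t \<in> mspace (E_metric n)" for s t using n by (simp add: p_def)
    have "bent_norm e (to_R3 (f (p s t)) - to_R3 (f (p s' t'))) =
        4 * sqrt ((s - s')^2 + (t - t')^2)" for s t s' t'
    proof -
      have "(\<Sum>i<n. (p s t i - p s' t' i)^2) = (\<Sum>i<2. (p s t i - p s' t' i)^2)"
        using n by (intro sum.mono_neutral_right) (auto simp: p_def)
      also have "\<dots> = (s - s')^2 + (t - t')^2" by (simp add: p_def numeral_2_eq_2)
      finally show ?thesis
        using isometric_map_dist[OF f p p, of s t s' t'] e
        by (simp add: mdist_bent mdist_E L2_set_def)
    qed
    then show False by (rule bent_norm_no_isometry[OF e, where h = "\<lambda>s t. to_R3 (f (p s t))"])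
  qed
  then show "enat n \<le> 1" by (simp add: one_enat_def)
qed

lemma rank_E_ge: "isometric_map (E_metric n) X f \<Longrightarrow> enat n \<le> rank_E X"
  unfolding rank_E_def by (rule SUP_upper) blast

lemma rank_bent_product_ge: "3 \<le> rank_E (prod_metric (bent_metric 1) (bent_metric (-1)))"
proof -
  have "mdist (prod_metric (bent_metric 1) (bent_metric (-1))) (x, x) (y, y) = mdist (E_metric 3) x y"
    for x y
  proof -
    define v where "v = to_R3 x - to_R3 y"
    have "(bent_norm 1 v / 4)^2 + (bent_norm (-1) v / 4)^2 = (norm v)^2"
      by (simp add: power_divide bent_norm_sq) (simp add: bent_sq_def field_simps)
    also have "norm v = L2_set (\<lambda>i. x i - y i) {..<3}"
      by (simp add: v_def to_R3_def norm_Pair L2_set_def numeral_3_eq_3 numeral_2_eq_2 add.assoc)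
    finally show ?thesis
      by (simp add: prod_dist_def mdist_bent mdist_E v_def L2_set_nonneg)
  qed
  then have "isometric_map (E_metric 3) (prod_metric (bent_metric 1) (bent_metric (-1))) (\<lambda>x. (x, x))"
    by (auto simp: isometric_map_def mspace_bent)
  from rank_E_ge[OF this] show ?thesis by (simp add: numeral_eq_enat)
qed

section \<open>Superadditivity of the rank\<close>

text \<open>The sum of squares splits into the first \<open>n\<close> and the next \<open>m\<close>
  coordinates. Filling up with 0 keeps each block in the carrier of its Euclidean space.\<close>

lemma isometric_map_concat:
  assumes f: "isometric_map (E_metric n) X f" and g: "isometric_map (E_metric m) Y g"
  shows "isometric_map (E_metric (n + m)) (prod_metric X Y)
    (\<lambda>x. (f (\<lambda>i. if i < n then x i else 0), g (\<lambda>i. if i < m then x (n + i) else 0)))"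
proof -
  define p q :: "(nat \<Rightarrow> real) \<Rightarrow> nat \<Rightarrow> real"
    where "p x = (\<lambda>i. if i < n then x i else 0)" and "q x = (\<lambda>i. if i < m then x (n + i) else 0)"
    for x
  have pq: "p x \<in> mspace (E_metric n)" "q x \<in> mspace (E_metric m)" for x
    by (auto simp: p_def q_def)
  have "mdist X (f (p x)) (f (p y)) ^ 2 + mdist Y (g (q x)) (g (q y)) ^ 2 =
      mdist (E_metric (n + m)) x y ^ 2" for x y
  proof -
    have "(\<Sum>i<n + m. (x i - y i)^2) = (\<Sum>i<n. (x i - y i)^2) + (\<Sum>i<m. (x (n + i) - y (n + i))^2)"
      by (induction m) auto
    then show ?thesis
      by (simp add: isometric_map_dist[OF f pq(1) pq(1)] isometric_map_dist[OF g pq(2) pq(2)]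
          mdist_E L2_set_def sum_nonneg) (simp add: p_def q_def)
  qed
  then have "mdist (prod_metric X Y) (f (p x), g (q x)) (f (p y), g (q y)) = mdist (E_metric (n + m)) x y"
    for x y
    by (simp add: prod_dist_def)
  then have "isometric_map (E_metric (n + m)) (prod_metric X Y) (\<lambda>x. (f (p x), g (q x)))"
    using f g pq by (auto simp: isometric_map_def Pi_iff)
  then show ?thesis by (simp add: p_def q_def)
qed

text \<open>Covers infinite rank, where the supremum is not attained. For \<open>k = 0\<close> a
  constant map on the one-point space serves, hence nonemptiness; for a successor \<open>k\<close>,
  the predecessor lies strictly below the supremum.\<close>

lemma rank_E_witness:
  assumes "mspace X \<noteq> {}" "enat k \<le> rank_E X"
  shows "\<exists>n f. k \<le> n \<and> isometric_map (E_metric n) X f"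
proof (cases k)
  case 0
  obtain c where "c \<in> mspace X" using assms by blast
  then have "isometric_map (E_metric 0) X (\<lambda>_. c)"
    by (auto simp: isometric_map_def mdist_E)
  then show ?thesis using 0 by blast
next
  case (Suc j)
  then have "enat j < rank_E X" using assms(2) by (metis enat_ord_simps(2) lessI less_le_trans)
  then obtain n f where "isometric_map (E_metric n) X f" "enat j < enat n"
    unfolding rank_E_def less_SUP_iff by blast
  then show ?thesis using Suc by (metis Suc_leI enat_ord_simps(2))
qed

text \<open>Testing finite lower bounds suffices: if one summand is infinite, pairing its lower
  bounds with 0 forces \<open>c\<close> to be infinite.\<close>

lemma enat_add_leI:
  fixes a b c :: enat
  assumes "\<And>i j. enat i \<le> a \<Longrightarrow> enat j \<le> b \<Longrightarrow> enat (i + j) \<le> c"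
  shows "a + b \<le> c"
proof (cases "a = \<infinity> \<or> b = \<infinity>")
  case True
  then have "enat i \<le> c" for i using assms[of i 0] assms[of 0 i] by (auto simp flip: zero_enat_def)
  then have "c = \<infinity>" by (metis enat_ord_simps(1) not_enat_eq Suc_n_not_le_n)
  then show ?thesis by simp
next
  case False
  then obtain i j where "a = enat i" "b = enat j" by auto
  then show ?thesis using assms by simp
qed

lemma rank_E_superadditive:
  assumes X: "mspace X \<noteq> {}" and Y: "mspace Y \<noteq> {}"
  shows "rank_E X + rank_E Y \<le> rank_E (prod_metric X Y)"
proof (rule enat_add_leI)
  fix i j assume i: "enat i \<le> rank_E X" and j: "enat j \<le> rank_E Y"
  obtain n f where nf: "i \<le> n" "isometric_map (E_metric n) X f"
    using rank_E_witness[OF X i] by blast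
  obtain m g where mg: "j \<le> m" "isometric_map (E_metric m) Y g"
    using rank_E_witness[OF Y j] by blast
  have "enat (i + j) \<le> enat (n + m)" using nf mg by simp
  also have "\<dots> \<le> rank_E (prod_metric X Y)"
    by (rule rank_E_ge[OF isometric_map_concat[OF nf(2) mg(2)]])
  finally show "enat (i + j) \<le> rank_E (prod_metric X Y)" .
qed

theorem theorem3:
  shows "(\<forall>(X1 :: 'a metric) (X2 :: 'b metric).
            mspace X1 \<noteq> {} \<and> mspace X2 \<noteq> {} \<longrightarrow>
            rank_E X1 + rank_E X2 \<le> rank_E (prod_metric X1 X2)) \<and>
         (\<exists>(Y1 :: (nat \<Rightarrow> real) metric) (Y2 :: (nat \<Rightarrow> real) metric).
            mspace Y1 \<noteq> {} \<and> mspace Y2 \<noteq> {} \<and>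
            rank_E Y1 + rank_E Y2 < rank_E (prod_metric Y1 Y2))"
proof (intro conjI allI impI exI)
  fix X1 :: "'a metric" and X2 :: "'b metric"
  assume "mspace X1 \<noteq> {} \<and> mspace X2 \<noteq> {}"
  then show "rank_E X1 + rank_E X2 \<le> rank_E (prod_metric X1 X2)"
    by (simp add: rank_E_superadditive)
next
  have "(\<lambda>_. 0) \<in> mspace (E_metric 3)" by simp
  then show "mspace (bent_metric 1) \<noteq> {}" "mspace (bent_metric (-1)) \<noteq> {}"
    by (auto simp: mspace_bent simp del: mspace_E)
  have "rank_E (bent_metric 1) + rank_E (bent_metric (-1)) \<le> 1 + 1"
    by (intro add_mono rank_bent_le) auto
  also have "(1 + 1 :: enat) < 3" by (simp add: one_enat_def numeral_eq_enat)
  also note rank_bent_product_ge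
  finally show "rank_E (bent_metric 1) + rank_E (bent_metric (-1)) <
      rank_E (prod_metric (bent_metric 1) (bent_metric (-1)))" .
qed

end
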